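(* Let $\vec m$ be an $n\times n$ difference-bound matrix over $\overline{\mathbb I}$ (with $\mathbb I\in\{\mathbb Z,\mathbb Q,\mathbb R\}$), let $k\in\{2,\dots,n\}$, let $e$ be an arithmetic expression over the variables $\{v_2,\dots,v_n\}$, and let $\vec m_{(v_k\leftarrow e)}$ be the result of the assignment transfer function defined in the context. Then $$\mathcal D^0(\vec m_{(v_k\leftarrow e)})\supseteq\{(x_2,\dots,x_{k-1},e(x_2,\dots,x_n),x_{k+1},\dots,x_n)\;|\;(x_2,\dots,x_n)\in\mathcal D^0(\vec m)\}.$$
   Context: Let $\mathbb I$ be $\mathbb Z$, $\mathbb Q$ or $\mathbb R$, and $\overline{\mathbb I}=\mathbb I\cup\{+\infty\}$ with the usual extended order, minimum and addition ($+\infty\pm c=+\infty$ for $c\in\mathbb I$). Variables are $v_1,\dots,v_n$, with $v_1$ standing for the constant $0$ and $v_2,\dots,v_n$ the program variables. A difference-bound matrix (DBM) is an $n\times n$ matrix $\vec m$ with entries in $\overline{\mathbb I}$. Define $\mathcal D(\vec m)=\{(x_1,\dots,x_n)\in\mathbb I^n\;|\;\forall i,j,\ x_j-x_i\leq\vec m_{ij}\}$ and the $\mathcal V^0$-domain $\mathcal D^0(\vec m)=\{(x_2,\dots,x_n)\in\mathbb I^{n-1}\;|\;(0,x_2,\dots,x_n)\in\mathcal D(\vec m)\}$. The expression $e$ denotes a function $\mathbb I^{n-1}\to\mathbb I$, $(x_2,\dots,x_n)\mapsto e(x_2,\dots,x_n)$. Projection: $\pi_{|v_k}(\vec m)=\{x\in\mathbb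 I\;|\;\exists(x_2,\dots,x_n)\in\mathcal D^0(\vec m),\ x=x_k\}$. Forget operator: $(\vec m_{\backslash v_k})_{ij}=\min(\vec m_{ij},\vec m_{ik}+\vec m_{kj})$ if $i\neq k$ and $j\neq k$; $0$ if $i=j=k$; $+\infty$ otherwise. Guard: for $i\neq j$ and $c\in\mathbb I$, $\vec m_{(v_j-v_i\leq c)}$ is the DBM obtained from $\vec m$ by replacing the entry $\vec m_{ij}$ by $\min(\vec m_{ij},c)$, leaving the other entries unchanged. Assignment transfer function $\vec m_{(v_{i_0}\leftarrow e)}$, for $i_0\in\{2,\dots,n\}$ (with $c\in\mathbb I$): (1) If $e=v_{i_0}+c$: $(\vec m_{(v_{i_0}\leftarrow v_{i_0}+c)})_{ij}$ equals $\vec m_{ij}-c$ if $i=i_0,\ j\neq i_0$; $\vec m_{ij}+c$ if $i\neq i_0,\ j=i_0$; and $\vec m_{ij}$ otherwise. (2) If $e=v_{j_0}+c$ with $j_0\neq i_0$: $\vec m_{(v_{i_0}\leftarrow v_{j_0}+c)}=((\vec m_{\backslash v_{i_0}})_{(v_{i_0}-v_{j_0}\leq c)})_{(v_{j_0}-v_{i_0}\leq -c)}$. The case $e=c$ is the special case $j_0=1$. (3) In all other cases, choose (by interval arithmetic) $e^+,e^-\in\overline{\mathbb I}$ such that the interval $[-e^-,e^+]$ (bounds included only if finite) contains $e(\pi_{|v_2}(\vec m),\dots,\pi_{|v_n}(\vec m))$, the image under $e$ of the product of the projections, and set $(\vec m_{(v_{i_0}\leftarrow e)})_{ij}$ equal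 to $e^+$ if $i=1$ and $j=i_0$; $e^-$ if $j=1$ and $i=i_0$; and $(\vec m_{\backslash v_{i_0}})_{ij}$ otherwise. *)

theory Defs
  imports "HOL-Library.Extended_Real" "HOL-Library.FuncSet"
begin

text \<open>
  The scalar domain is a subset I of the reals (the integers, the rationals or all reals).
  Tuples indexed by p, ..., n are extensional functions on {p..n}. Matrices are total
  functions of which only the entries with indices in {1..n} matter.
\<close>

type_synonym dbm = "nat \<Rightarrow> nat \<Rightarrow> ereal"

definition ext_scalars :: "real set \<Rightarrow> ereal set" where
  "ext_scalars I = insert \<infinity> (ereal ` I)"

definition is_dbm :: "nat \<Rightarrow> real set \<Rightarrow> dbm \<Rightarrow> bool" where
  "is_dbm n I m \<longleftrightarrow> (\<forall>i\<in>{1..n}. \<forall>j\<in>{1..n}. m i j \<in> ext_scalars I)"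

definition domain :: "nat \<Rightarrow> real set \<Rightarrow> dbm \<Rightarrow> (nat \<Rightarrow> real) set" where
  "domain n I m =
     {x \<in> {1..n} \<rightarrow>\<^sub>E I. \<forall>i\<in>{1..n}. \<forall>j\<in>{1..n}. ereal (x j - x i) \<le> m i j}"

definition domain0 :: "nat \<Rightarrow> real set \<Rightarrow> dbm \<Rightarrow> (nat \<Rightarrow> real) set" where
  "domain0 n I m = {x \<in> {2..n} \<rightarrow>\<^sub>E I. x(1 := 0) \<in> domain n I m}"

definition projection :: "nat \<Rightarrow> real set \<Rightarrow> dbm \<Rightarrow> nat \<Rightarrow> real set" where
  "projection n I m k = {x \<in> I. \<exists>y \<in> domain0 n I m. x = y k}"

definition forget :: "dbm \<Rightarrow> nat \<Rightarrow> dbm" where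
  "forget m k = (\<lambda>i j.
     if i \<noteq> k \<and> j \<noteq> k then min (m i j) (m i k + m k j)
     else if i = k \<and> j = k then 0
     else \<infinity>)"

text \<open>The guard \<open>guard m j i c\<close> adds the constraint \<open>v\<^sub>j - v\<^sub>i \<le> c\<close>, which lives in entry (i, j).\<close>

definition guard :: "dbm \<Rightarrow> nat \<Rightarrow> nat \<Rightarrow> real \<Rightarrow> dbm" where
  "guard m j i c = (\<lambda>p q. if p = i \<and> q = j then min (m i j) (ereal c) else m p q)"

definition shift :: "dbm \<Rightarrow> nat \<Rightarrow> real \<Rightarrow> dbm" where
  "shift m k c = (\<lambda>i j.
     if i = k \<and> j \<noteq> k then m i j - ereal c
     else if i \<noteq> k \<and> j = k then m i j + ereal c
     else m i j)"

definition set_bounds :: "dbm \<Rightarrow> nat \<Rightarrow> ereal \<Rightarrow> ereal \<Rightarrow> dbm" where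
  "set_bounds m k e_minus e_plus = (\<lambda>i j.
     if i = 1 \<and> j = k then e_plus
     else if j = 1 \<and> i = k then e_minus
     else forget m k i j)"

text \<open>
  The assignment distinguishes expressions by their form: \<open>VarPlus j c\<close> is the expression
  \<open>v\<^sub>j + c\<close>, which is the constant c if j = 1. Any other arithmetic expression is
  represented by the function it denotes; this function is arbitrary, since an expression
  of another form (such as \<open>v\<^sub>2 + v\<^sub>3 - v\<^sub>3\<close>) may still denote the same function
  as some \<open>v\<^sub>j + c\<close>.
\<close>

datatype expr = VarPlus nat real | OtherExpr "(nat \<Rightarrow> real) \<Rightarrow> real"

fun is_expr :: "nat \<Rightarrow> real set \<Rightarrow> expr \<Rightarrow> bool" where
  "is_expr n I (VarPlus j c) \<longleftrightarrow> j \<in> {1..n} \<and> c \<in> I"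
| "is_expr n I (OtherExpr f) \<longleftrightarrow> f \<in> ({2..n} \<rightarrow>\<^sub>E I) \<rightarrow> I"

fun denotes :: "expr \<Rightarrow> (nat \<Rightarrow> real) \<Rightarrow> real" where
  "denotes (VarPlus j c) x = (x(1 := 0)) j + c"
| "denotes (OtherExpr f) x = f x"

text \<open>
  \<open>assignment n I m k e m'\<close> says that m' is a result of the assignment of e to the k-th
  variable. It is a relation because the interval bounds in the last rule may be any sound ones.
  An infinite bound is never attained, since y is a real number.
\<close>

inductive assignment :: "nat \<Rightarrow> real set \<Rightarrow> dbm \<Rightarrow> nat \<Rightarrow> expr \<Rightarrow> dbm \<Rightarrow> bool"
  for n :: nat and I :: "real set" and m :: dbm and k :: nat
where
  same_var: "assignment n I m k (VarPlus k c) (shift m k c)"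
| other_var: "j \<noteq> k \<Longrightarrow>
    assignment n I m k (VarPlus j c) (guard (guard (forget m k) k j c) j k (- c))"
| other_expr: "e_plus \<in> ext_scalars I \<Longrightarrow> e_minus \<in> ext_scalars I \<Longrightarrow>
    f ` (\<Pi>\<^sub>E i\<in>{2..n}. projection n I m i) \<subseteq> {y \<in> I. - e_minus \<le> ereal y \<and> ereal y \<le> e_plus} \<Longrightarrow>
    assignment n I m k (OtherExpr f) (set_bounds m k e_minus e_plus)"

end

theory Submission
  imports Defs
begin

text \<open>Fix a point of the old domain, pin coordinate 1 to 0, and write its new value into
  coordinate k; every entry of the new matrix must bound the matching difference. For a translation
  of \<open>v_k\<close> the differences through k move by exactly the amount added to the entries
  (\<open>shift_sound\<close>). Otherwise the forgotten matrix accepts any value at k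
  (\<open>forget_sound\<close>), and the constraints put back afterwards are true of the value of
  \<open>e\<close> (\<open>guard_sound\<close>, \<open>domain0_in_PiE_projection\<close>).\<close>

lemma domain0_updI:
  assumes "x \<in> domain0 n I m" "k \<in> {2..n}" "v \<in> I"
    and "\<And>i j. i \<in> {1..n} \<Longrightarrow> j \<in> {1..n} \<Longrightarrow>
      ereal (((x(1 := 0))(k := v)) j - ((x(1 := 0))(k := v)) i) \<le> m' i j"
  shows "x(k := v) \<in> domain0 n I m'"
proof -
  have x: "x \<in> {2..n} \<rightarrow>\<^sub>E I" and y: "x(1 := 0) \<in> {1..n} \<rightarrow>\<^sub>E I"
    using assms(1) by (auto simp: domain0_def domain_def)
  have "x(k := v) \<in> {2..n} \<rightarrow>\<^sub>E I"
    using PiE_fun_upd[OF assms(3) x, of k] assms(2) by (simp add: insert_absorb)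
  moreover have "(x(1 := 0))(k := v) \<in> {1..n} \<rightarrow>\<^sub>E I"
    using PiE_fun_upd[OF assms(3) y, of k] assms(2) by (simp add: insert_absorb)
  \<comment> \<open>The updates commute because k is at least 2.\<close>
  moreover have "(x(k := v))(1 := 0) = (x(1 := 0))(k := v)"
    using assms(2) by (auto simp: fun_eq_iff)
  ultimately show ?thesis
    using assms(4) unfolding domain0_def domain_def by (simp del: fun_upd_apply)
qed

text \<open>The value v is arbitrary: off k the point is unchanged, and the path through k is
  bounded by the triangle argument with the old value \<open>y k\<close> as the intermediate
  point.\<close>

lemma forget_sound:
  assumes "y \<in> domain n I m" "k \<in> {1..n}" "i \<in> {1..n}" "j \<in> {1..n}"
  shows "ereal ((y(k := v)) j - (y(k := v)) i) \<le> forget m k i j"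
proof (cases "i \<noteq> k \<and> j \<noteq> k")
  case True
  have le: "ereal (y q - y p) \<le> m p q" if "p \<in> {1..n}" "q \<in> {1..n}" for p q
    using assms(1) that by (auto simp: domain_def)
  have "ereal (y j - y i) = ereal (y k - y i) + ereal (y j - y k)"
    by simp
  also have "\<dots> \<le> m i k + m k j"
    using assms by (intro add_mono le)
  finally show ?thesis
    using True le[OF assms(3,4)] by (simp add: forget_def)
qed (auto simp: forget_def)

lemma shift_sound:
  assumes "y \<in> domain n I m" "i \<in> {1..n}" "j \<in> {1..n}"
  shows "ereal ((y(k := y k + c)) j - (y(k := y k + c)) i) \<le> shift m k c i j"
proof -
  have "ereal (y j - y i) \<le> m i j"
    using assms by (auto simp: domain_def)
  \<comment> \<open>Infinite entries absorb the shift, and an entry of minus infinity is excluded by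
    the real lower bound.\<close>
  then show ?thesis
    by (cases "m i j") (auto simp: shift_def)
qed

lemma guard_sound:
  assumes "ereal (z q - z p) \<le> m p q" "z j - z i \<le> c"
  shows "ereal (z q - z p) \<le> guard m j i c p q"
  using assms by (auto simp: guard_def)

lemma domain0_in_PiE_projection:
  assumes "x \<in> domain0 n I m"
  shows "x \<in> (\<Pi>\<^sub>E i\<in>{2..n}. projection n I m i)"
  using assms by (force simp: projection_def domain0_def)

theorem theorem13:
  fixes I :: "real set" and n k :: nat and m m' :: dbm and e :: expr
  assumes "I \<in> {\<int>, \<rat>, \<real>}"
    and "is_dbm n I m"
    and "k \<in> {2..n}"
    and "is_expr n I e"
    and "assignment n I m k e m'"
  shows "domain0 n I m' \<supseteq> {x(k := denotes e x) | x. x \<in> domain0 n I m}"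
proof -
  have "x(k := denotes e x) \<in> domain0 n I m'" if x: "x \<in> domain0 n I m" for x
  proof -
    have y: "x(1 := 0) \<in> domain n I m" and xI: "x \<in> {2..n} \<rightarrow>\<^sub>E I"
      using x by (auto simp: domain0_def)
    have k: "k \<in> {1..n}" "k \<noteq> 1"
      using assms(3) by auto
    have v: "denotes e x \<in> I"
    proof (cases e)
      case (VarPlus j c)
      have "x(1 := 0) \<in> {1..n} \<rightarrow>\<^sub>E I"
        using y by (simp add: domain_def)
      then have "(x(1 := 0)) j \<in> I" "c \<in> I"
        using assms(4) VarPlus by (auto simp del: fun_upd_apply)
      \<comment> \<open>Each of the three scalar domains is closed under addition.\<close>
      then show ?thesis
        using assms(1) VarPlus by (auto intro: Ints_add Rats_add Reals_add)
    next
      case (OtherExpr f)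
      then show ?thesis
        using assms(4) xI by auto
    qed
    show ?thesis
      using assms(5)
    proof cases
      case (same_var c)
      have "denotes e x = (x(1 := 0)) k + c"
        using same_var by simp
      then show ?thesis
        using domain0_updI[OF x assms(3) v] shift_sound[OF y] same_var by metis
    next
      case (other_var j c)
      have "denotes e x = (x(1 := 0)) j + c"
        using other_var by simp
      \<comment> \<open>Since j differs from k, coordinate j keeps its old value, so the new
        difference between k and j is exactly c and both guards hold with equality. For j = 1 the
        pinned 0 makes this the constant assignment.\<close>
      then show ?thesis
        unfolding other_var(2)
        using other_var(3)
        by (intro domain0_updI[OF x assms(3) v] guard_sound forget_sound[OF y k(1)]) auto
    next
      case (other_expr e_plus e_minus f)
      \<comment> \<open>The point lies in the product of its own projections, so the interval
        contains its image.\<close>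
      have bounds: "- e_minus \<le> ereal (f x)" "ereal (f x) \<le> e_plus"
        using domain0_in_PiE_projection[OF x] other_expr by blast+
      from bounds(1) have "ereal (- f x) \<le> e_minus"
        by (cases e_minus) auto
      moreover have "denotes e x = f x"
        using other_expr by simp
      \<comment> \<open>As k differs from 1, coordinate 1 is still 0, so entries (1, k) and (k, 1)
        bound \<open>f x\<close> and its negative; the rest is forgetting.\<close>
      ultimately show ?thesis
        unfolding other_expr(2)
        using bounds(2) k(2) forget_sound[OF y k(1)]
        by (intro domain0_updI[OF x assms(3) v])
          (auto simp: set_bounds_def)
    qed
  qed
  then show ?thesis
    by auto
qed

end
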